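(* Let $A:\mathbb{F}^d\to\mathbb{F}^d$ be a linear operator, and let $W$ be a $K$-dimensional subspace of $\mathbb{F}^d$. If $\{b_1,\dots,b_L\}\subset\mathbb{F}^d$ form a complete set for the source recovery problem (for $A$ and $W$), then $L\ge K$.
   Context: $\mathbb{F}$ is $\mathbb{R}$ or $\mathbb{C}$, and $\langle x,y\rangle=y^*x$ is the canonical inner product on $\mathbb{F}^d$. Source recovery problem: given $A$ with adjoint $A^*$, a subspace $W\subseteq\mathbb{F}^d$ and vectors $b_1,\dots,b_L\in\mathbb{F}^d$ (called spatial observational vectors), consider the dynamics $x(n+1)=A^*x(n)+\omega$, $n\in\mathbb{N}_0$, $x(0)=x_0$, where the constant source $\omega\in W$ and the initial state $x_0\in\mathbb{F}^d$ are unknown, with measurements $y_\ell(n)=\langle x(n),b_\ell\rangle$, $1\le\ell\le L$. The set $\{b_1,\dots,b_L\}$ is complete if every $\omega\in W$ can be recovered, regardless of $x_0$, by finitely many linear operations from finitely many measurements; that is, there exist $T\in\mathbb{N}_0$ and vectors $u_{n,\ell}\in\mathbb{F}^d$ ($0\le n\le T$, $1\le\ell\le L$) such that $\omega=\sum_{n,\ell}y_\ell(n)\,u_{n,\ell}$ for all $x_0\in\mathbb{F}^d$ and all $\omega\in W$. *)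

theory Defs
  imports "HOL-Analysis.Analysis" "Jordan_Normal_Form.Conjugate"
begin

text \<open>
  All notions are stated once for a field with a conjugation; on \<^typ>\<open>real\<close> the
  conjugation is the identity and on \<^typ>\<open>complex\<close> it is \<^const>\<open>cnj\<close>.
  The library constants \<^const>\<open>inner\<close> and \<^const>\<open>adjoint\<close> are not used because on
  complex vectors they refer to the underlying real inner product.
\<close>

definition sesq :: "'f::conjugatable_field ^ 'd \<Rightarrow> 'f ^ 'd \<Rightarrow> 'f" where
  "sesq x y = (\<Sum>i\<in>UNIV. conjugate (y $ i) * x $ i)"

definition adj :: "('f::conjugatable_field ^ 'd \<Rightarrow> 'f ^ 'd) \<Rightarrow> 'f ^ 'd \<Rightarrow> 'f ^ 'd" where
  "adj A = (THE B. \<forall>x y. sesq (A x) y = sesq x (B y))"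

primrec trajectory ::
  "('f::conjugatable_field ^ 'd \<Rightarrow> 'f ^ 'd) \<Rightarrow> 'f ^ 'd \<Rightarrow> 'f ^ 'd \<Rightarrow> nat \<Rightarrow> 'f ^ 'd" where
  "trajectory A \<omega> x0 0 = x0"
| "trajectory A \<omega> x0 (Suc n) = adj A (trajectory A \<omega> x0 n) + \<omega>"

definition measurement ::
  "('f::conjugatable_field ^ 'd \<Rightarrow> 'f ^ 'd) \<Rightarrow> (nat \<Rightarrow> 'f ^ 'd) \<Rightarrow>
    'f ^ 'd \<Rightarrow> 'f ^ 'd \<Rightarrow> nat \<Rightarrow> nat \<Rightarrow> 'f" where
  "measurement A b \<omega> x0 l n = sesq (trajectory A \<omega> x0 n) (b l)"

text \<open>
  The observational vectors are the family \<open>b 1, \<dots>, b L\<close> (repetitions allowed); values of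
  \<open>b\<close> at other indices are irrelevant.
\<close>

definition complete_for_source_recovery ::
  "('f::conjugatable_field ^ 'd \<Rightarrow> 'f ^ 'd) \<Rightarrow> ('f ^ 'd) set \<Rightarrow> nat \<Rightarrow>
    (nat \<Rightarrow> 'f ^ 'd) \<Rightarrow> bool" where
  "complete_for_source_recovery A W L b \<longleftrightarrow>
    (\<exists>(T::nat) (u :: nat \<Rightarrow> nat \<Rightarrow> 'f ^ 'd). \<forall>x0. \<forall>\<omega>\<in>W.
      \<omega> = (\<Sum>n=0..T. \<Sum>l=1..L. measurement A b \<omega> x0 l n *s u n l))"

lemma sesq_axis: "sesq (axis i 1) y = conjugate (y $ i)"
proof -
  have "sesq (axis i 1) y = (\<Sum>j\<in>UNIV. if j = i then conjugate (y $ j) else 0)"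
    unfolding sesq_def by (rule sum.cong) (auto simp: axis_def)
  then show ?thesis by simp
qed

lemma sesq_right_cancel:
  assumes "\<And>x. sesq x y = sesq x z"
  shows "y = z"
  using assms[of "axis _ 1"] by (simp add: sesq_axis vec_eq_iff)

lemma sesq_adj:
  fixes A :: "'f::conjugatable_field ^ 'd \<Rightarrow> 'f ^ 'd"
  assumes "Vector_Spaces.linear (*s) (*s) A"
  shows "sesq (A x) y = sesq x (adj A y)"
proof -
  define M where "M = matrix A"
  have A: "A v $ i = (\<Sum>j\<in>UNIV. M $ i $ j * v $ j)" for v i
    using matrix_works[OF assms, of v] unfolding M_def
    by (metis (no_types) matrix_vector_mult_def vec_lambda_beta)
  define B :: "'f ^ 'd \<Rightarrow> 'f ^ 'd" where "B = (\<lambda>y. \<chi> j. \<Sum>i\<in>UNIV. conjugate (M $ i $ j) * y $ i)"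
  have B: "sesq (A v) w = sesq v (B w)" for v w
  proof -
    have "sesq (A v) w = (\<Sum>i\<in>UNIV. \<Sum>j\<in>UNIV. conjugate (w $ i) * (M $ i $ j * v $ j))"
      by (simp add: sesq_def A sum_distrib_left)
    also have "\<dots> = (\<Sum>j\<in>UNIV. \<Sum>i\<in>UNIV. conjugate (w $ i) * (M $ i $ j * v $ j))"
      by (rule sum.swap)
    also have "\<dots> = sesq v (B w)"
      by (simp add: sesq_def B_def sum_conjugate conjugate_dist_mul sum_distrib_right
          mult.assoc mult.left_commute)
    finally show ?thesis .
  qed
  have "\<forall>x y. sesq (A x) y = sesq x (adj A y)"
    unfolding adj_def
  proof (rule theI[where a = B])
    show "\<forall>x y. sesq (A x) y = sesq x (B y)" using B by blast
    show "C = B" if "\<forall>x y. sesq (A x) y = sesq x (C y)" for C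
      using that B by (metis sesq_right_cancel ext)
  qed
  then show ?thesis by blast
qed

lemma sesq_real_eq_inner: "sesq x y = inner x (y :: real ^ 'd)"
  by (simp add: sesq_def inner_vec_def mult.commute)

end

theory Submission
  imports Defs
begin

text \<open>
  The measurements are linear functionals of the pair of initial state and source. Passing from
  \<open>y\<^sub>l(n)\<close> to \<open>y\<^sub>l(n+1)\<close> is a linear map \<open>T\<close> on functionals, so the span \<open>X\<close> of all
  measurements is generated under \<open>T\<close> by the \<open>L\<close> functionals \<open>y\<^sub>l(0)\<close>, and
  \<open>X = (T - 1) X + span {y\<^sub>l(0)}\<close>. By rank-nullity \<open>T\<close> fixes a subspace of \<open>X\<close> of dimension
  at most \<open>L\<close>. Functionals of the source alone are fixed by \<open>T\<close>, and completeness puts a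
  \<open>K\<close>-dimensional space of them into \<open>X\<close>.
\<close>

lemma (in finite_dimensional_vector_space) dim_fixed_le_card_generators:
  assumes T: "Vector_Spaces.linear scale scale T" and G: "finite G"
    and Z: "Z \<subseteq> span (\<Union>n. (T ^^ n) ` G)" and fixed: "\<And>z. z \<in> Z \<Longrightarrow> T z = z"
  shows "dim Z \<le> card G"
proof -
  interpret T: Vector_Spaces.linear scale scale T by (rule T)
  define X where "X = span (\<Union>n. (T ^^ n) ` G)"
  define N where "N = (\<lambda>x. T x - x)"
  interpret N: Vector_Spaces.linear scale scale N
  proof
    show "N (x + y) = N x + N y" for x y by (simp add: N_def T.add)
    show "N (scale c x) = scale c (N x)" for c x by (simp add: N_def T.scale scale_right_diff_distrib)
  qed
  obtain B where B: "B \<subseteq> Z" "independent B" "card B = dim Z"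
    by (rule basis_exists)
  have "B \<subseteq> X" using B(1) Z by (simp add: X_def)
  then obtain C where C: "B \<subseteq> C" "C \<subseteq> X" "independent C" "X \<subseteq> span C"
    by (rule maximal_independent_subset_extend) (use B(2) in auto)
  have fin: "finite C" using C(3) by (rule finiteI_independent)
  \<comment> \<open>\<open>N\<close> kills \<open>B\<close>, so \<open>N\<close>
    C\<open>lies in the span of\<close>N \<open>(C - B)\<close>. Adding \<open>G\<close> recovers
    all of \<open>X\<close>, since T^(n+1) g = N (T^n g) + T^n g. Comparing sizes, card C \<le> card
    C - card B + card G.\<close>
  define H where "H = N ` (C - B) \<union> G"
  have "N c \<in> span H" if "c \<in> C" for c
  proof (cases "c \<in> B")
    case True
    then show ?thesis using B(1) fixed by (auto simp: N_def span_zero)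
  next
    case False
    then show ?thesis using that by (auto simp: H_def intro: span_base)
  qed
  then have "N ` span C \<subseteq> span H"
    unfolding N.span_image[symmetric] by (intro span_minimal) auto
  then have NX: "N x \<in> span H" if "x \<in> X" for x
    using that C(4) by blast
  have "(T ^^ n) g \<in> span H" if "g \<in> G" for n g
  proof (induction n)
    case 0
    then show ?case using that by (simp add: H_def span_base)
  next
    case (Suc n)
    have "(T ^^ n) g \<in> X" using that by (auto simp: X_def intro: span_base)
    then have "N ((T ^^ n) g) + (T ^^ n) g \<in> span H"
      using Suc NX by (intro span_add)
    then show ?case by (simp add: N_def)
  qed
  then have "X \<subseteq> span H"
    unfolding X_def by (intro span_minimal) auto
  moreover have "finite H" using fin G by (simp add: H_def)
  ultimately have "card C \<le> card H"
    using independent_card_le_dim[OF C(2,3)] dim_le_card le_trans by blast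
  also have "\<dots> \<le> card (C - B) + card G"
    unfolding H_def by (rule order_trans[OF card_Un_le]) (simp add: card_image_le fin)
  also have "card (C - B) = card C - card B"
    using C(1) fin by (meson card_Diff_subset finite_subset)
  finally show ?thesis
    using B(3) card_mono[OF fin C(1)] by linarith
qed

lemma sesq_add_left: "sesq (x + y) z = sesq x z + sesq y z"
  by (simp add: sesq_def algebra_simps sum.distrib)

lemma sesq_add_right: "sesq x (y + z) = sesq x y + sesq x z"
  by (simp add: sesq_def algebra_simps sum.distrib conjugate_dist_add)

lemma sesq_scale_left: "sesq (c *s x) y = c * sesq x y"
  by (simp add: sesq_def sum_distrib_left mult.left_commute)

lemma sesq_scale_right: "sesq x (c *s y) = conjugate c * sesq x y"
  by (simp add: sesq_def sum_distrib_left conjugate_dist_mul mult.assoc)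

lemma sesq_zero_left [simp]: "sesq 0 y = 0"
  by (simp add: sesq_def)

lemma sesq_zero_right [simp]: "sesq x 0 = 0"
  by (simp add: sesq_def)

lemma sesq_sum_left: "sesq (sum f I) y = (\<Sum>i\<in>I. sesq (f i) y)"
  by (induction I rule: infinite_finite_induct) (simp_all add: sesq_add_left)

lemma sesq_sum_right: "sesq x (sum f I) = (\<Sum>i\<in>I. sesq x (f i))"
  by (induction I rule: infinite_finite_induct) (simp_all add: sesq_add_right)

lemma conjugate_sesq: "conjugate (sesq x y) = sesq y x"
  by (simp add: sesq_def sum_conjugate conjugate_dist_mul mult.commute)

text \<open>Positivity of the form enters here: the terms of \<open>sesq x x\<close> are
  nonnegative, so a zero sum forces each to vanish.\<close>

lemma sesq_self_eq_0:
  fixes x :: "'f::conjugatable_ordered_field ^ 'd"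
  assumes "sesq x x = 0"
  shows "x = 0"
proof -
  have "\<forall>i\<in>UNIV. x $ i * conjugate (x $ i) = 0"
    using assms
    by (subst sum_nonneg_eq_0_iff[symmetric])
      (simp_all add: sesq_def mult.commute[of "conjugate _"] conjugate_square_positive)
  then show ?thesis by (simp add: vec_eq_iff)
qed

lemma sesq_adj_left:
  assumes "Vector_Spaces.linear (*s) (*s) A"
  shows "sesq (adj A x) y = sesq x (A y)"
  using sesq_adj[OF assms, of y x] conjugate_sesq by metis

text \<open>
  A pair \<open>(v, w)\<close> encodes the functional sending initial state \<open>x\<^sub>0\<close> and source \<open>\<omega>\<close> to
  \<open>sesq x\<^sub>0 v + sesq \<omega> w\<close>; precomposition with one step of the dynamics becomes the map below.
\<close>

definition shift :: "('a \<Rightarrow> 'a) \<Rightarrow> 'a \<times> 'a \<Rightarrow> 'a \<times> 'a::plus" where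
  "shift A = (\<lambda>(v, w). (A v, w + v))"

lemma sesq_trajectory:
  assumes A: "Vector_Spaces.linear (*s) (*s) A"
  shows "sesq (trajectory A \<omega> x0 n) v + sesq \<omega> w =
    sesq x0 (fst ((shift A ^^ n) (v, w))) + sesq \<omega> (snd ((shift A ^^ n) (v, w)))"
proof (induction n arbitrary: v w)
  \<comment> \<open><A* x + \<omega>, v> + <\<omega>, w> = <x, A v> + <\<omega>, w + v>. The new
    pair is fed to the induction hypothesis, hence arbitrary \<open>v\<close>, \<open>w\<close> and
    the power unfolded on the right.\<close>
  case (Suc n)
  from Suc[of "A v" "w + v"] show ?case
    by (simp add: funpow_Suc_right shift_def sesq_add_left sesq_add_right sesq_adj_left[OF A]
        ac_simps del: funpow.simps)
qed simp

interpretation vec_prod: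
  finite_dimensional_vector_space_prod "(*s)" "(*s)" cart_basis cart_basis ..

theorem dim_le_if_complete_for_source_recovery:
  fixes A :: "'f::conjugatable_ordered_field ^ 'd \<Rightarrow> 'f ^ 'd"
  assumes A: "Vector_Spaces.linear (*s) (*s) A" and W: "vec.subspace W"
    and complete: "complete_for_source_recovery A W L b"
  shows "vec.dim W \<le> L"
proof -
  interpret A: Vector_Spaces.linear "(*s)" "(*s)" A by (rule A)
  obtain T u where u: "\<And>x0 \<omega>. \<omega> \<in> W \<Longrightarrow>
      \<omega> = (\<Sum>n=0..T. \<Sum>l=1..L. measurement A b \<omega> x0 l n *s u n l)"
    using complete unfolding complete_for_source_recovery_def by blast
  define p where "p n l = (shift A ^^ n) (b l, 0)" for n l
  \<comment> \<open>Pairing the recovery formula with \<open>v\<close> writes <\<omega>, v> as a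
    combination of measurements. The second slot is conjugate-linear, so the coefficients <u, v> are
    encoded as their conjugates <v, u>, which makes \<open>e\<close> linear.\<close>
  define e where "e v = (\<Sum>n=0..T. \<Sum>l=1..L. vec_prod.scale (sesq v (u n l)) (p n l))" for v
  have fst_e: "fst (e v) = (\<Sum>n=0..T. \<Sum>l=1..L. sesq v (u n l) *s fst (p n l))"
    and snd_e: "snd (e v) = (\<Sum>n=0..T. \<Sum>l=1..L. sesq v (u n l) *s snd (p n l))" for v
    by (simp_all add: e_def fst_sum snd_sum vec_prod.scale_def)
  have m: "measurement A b \<omega> x0 l n = sesq x0 (fst (p n l)) + sesq \<omega> (snd (p n l))" for \<omega> x0 l n
    using sesq_trajectory[OF A, of \<omega> x0 n "b l" 0] by (simp add: measurement_def p_def)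
  have rec: "sesq \<omega> v = sesq x0 (fst (e v)) + sesq \<omega> (snd (e v))" if "\<omega> \<in> W" for \<omega> x0 v
    by (subst u[OF that, of x0])
      (simp add: fst_e snd_e m sesq_add_left sesq_sum_left sesq_sum_right sesq_scale_left sesq_scale_right
        conjugate_sesq distrib_right sum.distrib mult.commute)
  \<comment> \<open>Recovery regardless of \<open>x0\<close> is used here: at \<omega> = 0 the
    functional vanishes for every \<open>x0\<close>. So \<open>e v\<close> depends on the source
    alone and is fixed by \<open>shift A\<close>.\<close>
  have fst_e_0: "fst (e v) = 0" for v
    using rec[of 0] vec.subspace_0[OF W] by (intro sesq_right_cancel) simp
  interpret e: Vector_Spaces.linear "(*s)" vec_prod.scale e
    by unfold_locales
      (simp_all add: e_def sesq_add_left sesq_scale_left vec_prod.p.scale_left_distrib sum.distrib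
        vec_prod.p.scale_sum_right)
  interpret shift: Vector_Spaces.linear vec_prod.scale vec_prod.scale "shift A"
    by unfold_locales
      (auto simp: shift_def vec_prod.scale_def A.add A.scale vec.scale_right_distrib)
  interpret e_pair: finite_dimensional_vector_space_pair
    "(*s)" cart_basis vec_prod.scale "vec_prod.Basis_pair :: (('f ^ 'd) \<times> ('f ^ 'd)) set" ..
  \<comment> \<open>Taking \<omega> = v in \<open>rec\<close> gives <v, v> = 0.\<close>
  have "v = 0" if "v \<in> W" "e v = 0" for v
    using rec[OF that(1), of v 0] that(2) by (intro sesq_self_eq_0) simp
  then have "inj_on e W"
    using W e.inj_on_iff_eq_0 by blast
  then have "vec.dim W = vec_prod.p.dim (e ` W)"
    using W e_pair.dim_image_eq[OF e.linear_axioms, of W] vec.span_eq_iff by metis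
  also have "\<dots> \<le> card ((\<lambda>l. (b l, 0 :: 'f ^ 'd)) ` {1..L})"
  proof (rule vec_prod.p.dim_fixed_le_card_generators[OF shift.linear_axioms])
    show "e ` W \<subseteq> vec_prod.p.span (\<Union>n. (shift A ^^ n) ` (\<lambda>l. (b l, 0)) ` {1..L})"
      unfolding e_def p_def
      by (intro image_subsetI vec_prod.p.span_sum vec_prod.p.span_scale vec_prod.p.span_base) blast
    show "shift A z = z" if "z \<in> e ` W" for z
      using that fst_e_0 by (auto simp: shift_def prod_eq_iff split_beta)
  qed simp
  also have "\<dots> \<le> L"
    using card_image_le[of "{1..L}"] by fastforce
  finally show ?thesis .
qed

theorem corollary2p13:
  shows
    "(\<forall>(A :: real ^ 'd \<Rightarrow> real ^ 'd) (W :: (real ^ 'd) set) (K :: nat) (L :: nat)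
        (b :: nat \<Rightarrow> real ^ 'd).
        Vector_Spaces.linear (*s) (*s) A \<longrightarrow> vec.subspace W \<longrightarrow> vec.dim W = K \<longrightarrow>
        complete_for_source_recovery A W L b \<longrightarrow> L \<ge> K) \<and>
     (\<forall>(A :: complex ^ 'd \<Rightarrow> complex ^ 'd) (W :: (complex ^ 'd) set) (K :: nat) (L :: nat)
        (b :: nat \<Rightarrow> complex ^ 'd).
        Vector_Spaces.linear (*s) (*s) A \<longrightarrow> vec.subspace W \<longrightarrow> vec.dim W = K \<longrightarrow>
        complete_for_source_recovery A W L b \<longrightarrow> L \<ge> K)"
  by (auto intro: dim_le_if_complete_for_source_recovery)

end
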